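(* For all $n,k\in\mathbb{N}$, $\chi^k(\mathbb{R}^n)\ge \binom{n+1}{k}$.
   Context: Let $S\subseteq\mathbb{R}^n$ and $k,m\in\mathbb{N}$, and let $D=(d_{ij})$ be a $k\times m$ array of positive real numbers. $S$ is called $D$-colorable if there is a coloring $T:S\to\{C_1,\dots,C_m\}$ such that for all $1\le i\le k$ and $1\le j\le m$, no two points of $S$ at Euclidean distance $d_{ij}$ are both colored $C_j$. The $k^{\rm th}$ upper chromatic number $\chi^k(S)$ is the smallest integer $m$ such that $S$ is $D$-colorable for every $k\times m$ array $D$ of positive reals; if no such integer exists, $\chi^k(S)=\infty$. *)

theory Defs
  imports "HOL-Analysis.Analysis" "HOL-Library.Extended_Nat" "HOL-Library.FuncSet"
begin

text \<open>
  A \<open>k \<times> m\<close> array is a function \<open>D :: nat \<Rightarrow> nat \<Rightarrow> real\<close> of which only the entries \<open>D i j\<close>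
  with \<open>1 \<le> i \<le> k\<close> and \<open>1 \<le> j \<le> m\<close> are used; the colour \<open>C\<^sub>j\<close> is represented by its index \<open>j\<close>.
\<close>

definition D_colorable ::
    "nat \<Rightarrow> nat \<Rightarrow> (nat \<Rightarrow> nat \<Rightarrow> real) \<Rightarrow> 'a::metric_space set \<Rightarrow> bool" where
  "D_colorable k m D S \<longleftrightarrow>
     (\<exists>T \<in> S \<rightarrow> {1..m}. \<forall>i\<in>{1..k}. \<forall>j\<in>{1..m}.
        \<not> (\<exists>x\<in>S. \<exists>y\<in>S. dist x y = D i j \<and> T x = j \<and> T y = j))"

text \<open>The infimum of the empty set in \<^typ>\<open>enat\<close> is \<open>\<infinity>\<close>; a nonempty infimum is attained.\<close>

definition upper_chromatic :: "nat \<Rightarrow> 'a::metric_space set \<Rightarrow> enat" where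
  "upper_chromatic k S =
     Inf {enat m | m. \<forall>D. (\<forall>i\<in>{1..k}. \<forall>j\<in>{1..m}. D i j > 0) \<longrightarrow> D_colorable k m D S}"

end

theory Submission
  imports Defs
begin

text \<open>
  The points of \<open>{0,1}\<^sup>n\<^sup>+\<^sup>1\<close> with exactly \<open>k\<close> ones lie in a hyperplane, a copy of \<open>\<real>\<^sup>n\<close>, and any two
  of them are at one of the \<open>k\<close> distances \<open>sqrt (2 * i)\<close> with \<open>1 \<le> i \<le> k\<close>. If these distances
  are forbidden for every colour, then all these points must get different colours.
\<close>

lemma sum_indicator_UNIV:
  "(\<Sum>i\<in>UNIV. indicator A i :: real) = card (A :: 'a::finite set)"
  by (simp add: indicator_def)

text \<open>The squared distance counts the coordinates where the two 0/1 vectors differ, that is,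
  the symmetric difference. Each of its two halves has \<open>k - card (A \<inter> B)\<close>
  elements; this subtraction never truncates, as the intersection lies in a set of size
  \<open>k\<close>.\<close>

lemma dist_vec_indicator:
  fixes A B :: "'m::finite set"
  assumes "card A = k" "card B = k"
  shows "dist ((\<chi> i. indicator A i) :: real ^ 'm) (\<chi> i. indicator B i) = sqrt (2 * real (k - card (A \<inter> B)))"
proof -
  let ?C = "(A - B) \<union> (B - A)"
  have "(\<Sum>i\<in>UNIV. (indicator A i - indicator B i :: real)\<^sup>2) = (\<Sum>i\<in>UNIV. indicator ?C i)"
    by (intro sum.cong) (auto simp: indicator_def)
  also have "\<dots> = card ?C"
    by (rule sum_indicator_UNIV)
  also have "\<dots> = card (A - B) + card (B - A)"
    by (subst card_Un_disjoint) auto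
  also have "\<dots> = 2 * (k - card (A \<inter> B))"
    using assms by (simp add: card_Diff_subset_Int Int_commute)
  finally show ?thesis
    by (simp add: dist_norm norm_vec_def L2_set_def)
qed

text \<open>The type \<open>'n option\<close> supplies \<open>n + 1\<close> coordinates. The
  orthogonal complement of the all-ones vector has dimension \<open>n\<close>, and subspaces of
  equal dimension are linearly isometric.\<close>

lemma hyperplane_isometry:
  obtains f :: "real ^ 'n option \<Rightarrow> real ^ 'n"
  where "linear f" "\<And>x. (\<Sum>i\<in>UNIV. x $ i) = 0 \<Longrightarrow> norm (f x) = norm x"
proof -
  let ?a = "1 :: real ^ 'n option"
  have inner: "?a \<bullet> x = (\<Sum>i\<in>UNIV. x $ i)" for x
    by (simp add: inner_vec_def)
  have "dim {x. ?a \<bullet> x = 0} = DIM(real ^ 'n option) - 1"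
    by (rule dim_hyperplane) simp
  then have "dim {x. ?a \<bullet> x = 0} = dim (UNIV :: (real ^ 'n) set)"
    by (simp add: card_UNIV_option)
  then obtain f :: "real ^ 'n option \<Rightarrow> real ^ 'n"
    where "linear f" "\<And>x. x \<in> {x. ?a \<bullet> x = 0} \<Longrightarrow> norm (f x) = norm x"
    using isometry_subspaces[OF subspace_hyperplane subspace_UNIV] by metis
  with that inner show thesis
    by simp
qed

lemma equal_card_subsets_embedding:
  obtains p :: "'n::finite option set \<Rightarrow> real ^ 'n"
  where "\<And>A B. card A = k \<Longrightarrow> card B = k \<Longrightarrow> dist (p A) (p B) = sqrt (2 * real (k - card (A \<inter> B)))"
proof -
  obtain f :: "real ^ 'n option \<Rightarrow> real ^ 'n"
    where f: "linear f" "\<And>x. (\<Sum>i\<in>UNIV. x $ i) = 0 \<Longrightarrow> norm (f x) = norm x"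
    using hyperplane_isometry by blast
  define v :: "'n option set \<Rightarrow> real ^ 'n option" where "v A = (\<chi> i. indicator A i)" for A
  have "dist (f (v A)) (f (v B)) = sqrt (2 * real (k - card (A \<inter> B)))"
    if "card A = k" "card B = k" for A B
  proof -
    \<comment> \<open>The vectors themselves lie in the parallel hyperplane of coordinate sum
      \<open>k\<close>; only their differences lie where \<open>f\<close> preserves norms, which
      suffices for distances by linearity.\<close>
    have "(\<Sum>i\<in>UNIV. (v A - v B) $ i) = 0"
      using that by (simp add: v_def sum_subtractf sum_indicator_UNIV)
    then have "norm (f (v A - v B)) = norm (v A - v B)"
      by (rule f)
    then have "dist (f (v A)) (f (v B)) = dist (v A) (v B)"
      by (simp add: dist_norm linear_diff[OF f(1)])
    then show ?thesis
      using dist_vec_indicator[OF that] by (simp add: v_def)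
  qed
  then show thesis
    by (rule that)
qed

lemma D_colorable_sqrt_ge:
  assumes "D_colorable k m (\<lambda>i j. sqrt (2 * real i)) (UNIV :: (real ^ 'n) set)"
  shows "(CARD('n) + 1) choose k \<le> m"
proof -
  obtain T :: "real ^ 'n \<Rightarrow> nat" where T: "T \<in> UNIV \<rightarrow> {1..m}"
    and forbidden: "\<forall>i\<in>{1..k}. \<forall>j\<in>{1..m}.
      \<not> (\<exists>x\<in>UNIV. \<exists>y\<in>UNIV. dist x y = sqrt (2 * real i) \<and> T x = j \<and> T y = j)"
    using assms unfolding D_colorable_def by (rule bexE)
  have D: "T x \<noteq> T y" if "i \<in> {1..k}" "dist x y = sqrt (2 * real i)" for i x y
    using forbidden that T[THEN funcset_mem, OF UNIV_I, of y] by blast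
  obtain p :: "'n option set \<Rightarrow> real ^ 'n" where
    p: "\<And>A B. card A = k \<Longrightarrow> card B = k \<Longrightarrow> dist (p A) (p B) = sqrt (2 * real (k - card (A \<inter> B)))"
    using equal_card_subsets_embedding by blast
  \<comment> \<open>Written in the shape of \<open>n_subsets\<close>, which counts it at the
    end.\<close>
  let ?S = "{A :: 'n option set. A \<subseteq> UNIV \<and> card A = k}"
  have "inj_on (T \<circ> p) ?S"
  proof (rule inj_onI, rule ccontr)
    fix A B assume AB: "A \<in> ?S" "B \<in> ?S" "(T \<circ> p) A = (T \<circ> p) B" "A \<noteq> B"
    \<comment> \<open>Distinct sets of equal size are not nested, so the index of their distance is
      at least 1 and the distance is forbidden.\<close>
    have "A \<inter> B \<noteq> A"
      using AB card_subset_eq[of B A] by auto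
    then have "card (A \<inter> B) < card A"
      by (intro psubset_card_mono) auto
    then have "k - card (A \<inter> B) \<in> {1..k}"
      using AB by simp
    then have "T (p A) \<noteq> T (p B)"
      by (rule D) (use p[of A B] AB in simp)
    with AB show False
      by simp
  qed
  then have "card ?S \<le> card {1..m}"
    by (rule card_inj_on_le) (use T in auto)
  then show ?thesis
    by (simp only: n_subsets[OF finite] card_UNIV_option) simp
qed

theorem theorem2:
  fixes k :: nat
  shows "upper_chromatic k (UNIV :: (real ^ 'n) set) \<ge> enat ((CARD('n) + 1) choose k)"
  unfolding upper_chromatic_def
\<comment> \<open>Bounding every admissible \<open>m\<close> from below also covers the case of an
  infinite chromatic number, where there is none.\<close>
proof (rule Inf_greatest)
  fix c
  assume "c \<in> {enat m | m. \<forall>D. (\<forall>i\<in>{1..k}. \<forall>j\<in>{1..m}. D i j > 0) \<longrightarrow>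
    D_colorable k m D (UNIV :: (real ^ 'n) set)}"
  then obtain m where "c = enat m"
    and m: "\<And>D. (\<forall>i\<in>{1..k}. \<forall>j\<in>{1..m}. D i j > 0) \<Longrightarrow> D_colorable k m D (UNIV :: (real ^ 'n) set)"
    by blast
  have "D_colorable k m (\<lambda>i j. sqrt (2 * real i)) (UNIV :: (real ^ 'n) set)"
    by (rule m) simp
  then show "enat ((CARD('n) + 1) choose k) \<le> c"
    unfolding \<open>c = enat m\<close> using D_colorable_sqrt_ge by (simp only: enat_ord_simps)
qed

end
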